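(* Let $(A,\cdot)$ be an anti-pre-Lie algebra. If a bilinear map $\Omega:A\otimes A\to A$ generates a linear deformation of the anti-pre-Lie algebra $(A,\cdot)$, then the skew-symmetric bilinear map $\Omega_C:A\times A\to A$ defined by $\Omega_C(x,y)=\Omega(x,y)-\Omega(y,x)$ generates a linear deformation of the sub-adjacent Lie algebra $A^C$.
   Context: All vector spaces are over a field $\mathbb K$. An anti-pre-Lie algebra is a vector space $A$ with a bilinear product $\cdot$ such that for all $x,y,z\in A$, with $[x,y]=x\cdot y-y\cdot x$: (1) $x\cdot(y\cdot z)-y\cdot(x\cdot z)=[y,x]\cdot z$; (2) $[x,y]\cdot z+[y,z]\cdot x+[z,x]\cdot y=0$. The commutator $[x,y]=x\cdot y-y\cdot x$ makes $A$ a Lie algebra, called the sub-adjacent Lie algebra and denoted $A^C$. A linear map $\Omega:A\otimes A\to A$ generates a linear deformation of $(A,\cdot)$ if, for every parameter $t$, the product $x\cdot_t y=x\cdot y+t\,\Omega(x,y)$ makes $A$ an anti-pre-Lie algebra. For a Lie algebra $(\mathfrak g,[\cdot,\cdot])$, a skew-symmetric bilinear map $\Omega:\mathfrak g\times\mathfrak g\to\mathfrak g$ generates a (one-parameter) linear deformation of $(\mathfrak g,[\cdot,\cdot])$ if, for every parameter $t$, the bracket $[\cdot,\cdot]_t=[\cdot,\cdot]+t\,\Omega$ makes $\mathfrak g$ a Lie algebra. *)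

theory Defs
  imports Complex_Main
begin

definition bilinear_map ::
    "('k::field \<Rightarrow> 'a::ab_group_add \<Rightarrow> 'a) \<Rightarrow> ('a \<Rightarrow> 'a \<Rightarrow> 'a) \<Rightarrow> bool" where
  "bilinear_map scale f \<longleftrightarrow>
     (\<forall>x. Vector_Spaces.linear scale scale (\<lambda>y. f x y)) \<and>
     (\<forall>y. Vector_Spaces.linear scale scale (\<lambda>x. f x y))"

definition commutator :: "('a::ab_group_add \<Rightarrow> 'a \<Rightarrow> 'a) \<Rightarrow> 'a \<Rightarrow> 'a \<Rightarrow> 'a" where
  "commutator f x y = f x y - f y x"

locale anti_pre_lie_algebra = vector_space scale
  for scale :: "'k::field \<Rightarrow> 'a::ab_group_add \<Rightarrow> 'a" +
  fixes mult :: "'a \<Rightarrow> 'a \<Rightarrow> 'a"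
  assumes bilinear_mult: "bilinear_map scale mult"
    and anti_left_symmetry:
      "mult x (mult y z) - mult y (mult x z) = mult (commutator mult y x) z"
    and cyclic_identity:
      "mult (commutator mult x y) z + mult (commutator mult y z) x
        + mult (commutator mult z x) y = 0"

text \<open>The field may have characteristic 2, so the bracket of a Lie algebra is
  required to be alternating, which is then stronger than skew-symmetric.\<close>

locale lie_algebra = vector_space scale
  for scale :: "'k::field \<Rightarrow> 'a::ab_group_add \<Rightarrow> 'a" +
  fixes bracket :: "'a \<Rightarrow> 'a \<Rightarrow> 'a"
  assumes bilinear_bracket: "bilinear_map scale bracket"
    and alternating: "bracket x x = 0"
    and jacobi:
      "bracket x (bracket y z) + bracket y (bracket z x) + bracket z (bracket x y) = 0"

definition skew_symmetric :: "('a::ab_group_add \<Rightarrow> 'a \<Rightarrow> 'a) \<Rightarrow> bool" where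
  "skew_symmetric f \<longleftrightarrow> (\<forall>x y. f x y = - f y x)"

text \<open>The parameter \<open>t\<close> of a linear deformation ranges over the ground field.\<close>

definition generates_anti_pre_lie_deformation ::
    "('k::field \<Rightarrow> 'a::ab_group_add \<Rightarrow> 'a) \<Rightarrow> ('a \<Rightarrow> 'a \<Rightarrow> 'a) \<Rightarrow> ('a \<Rightarrow> 'a \<Rightarrow> 'a) \<Rightarrow> bool" where
  "generates_anti_pre_lie_deformation scale mult \<Omega> \<longleftrightarrow>
     anti_pre_lie_algebra scale mult \<and> bilinear_map scale \<Omega> \<and>
     (\<forall>t. anti_pre_lie_algebra scale (\<lambda>x y. mult x y + scale t (\<Omega> x y)))"

definition generates_lie_deformation ::
    "('k::field \<Rightarrow> 'a::ab_group_add \<Rightarrow> 'a) \<Rightarrow> ('a \<Rightarrow> 'a \<Rightarrow> 'a) \<Rightarrow> ('a \<Rightarrow> 'a \<Rightarrow> 'a) \<Rightarrow> bool" where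
  "generates_lie_deformation scale bracket \<Omega> \<longleftrightarrow>
     lie_algebra scale bracket \<and> bilinear_map scale \<Omega> \<and> skew_symmetric \<Omega> \<and>
     (\<forall>t. lie_algebra scale (\<lambda>x y. bracket x y + scale t (\<Omega> x y)))"

end

theory Submission imports Defs begin

text \<open>The commutator of any anti-pre-Lie product is a Lie bracket, and taking commutators is
  linear in the product, so the commutator of the deformed product is the deformed commutator.\<close>

lemma bilinear_map_commutator:
  fixes scale :: "'k::field \<Rightarrow> 'a::ab_group_add \<Rightarrow> 'a"
  assumes "bilinear_map scale f"
  shows "bilinear_map scale (commutator f)"
proof -
  have lin: "Vector_Spaces.linear scale scale (\<lambda>y. f x y)"
    "Vector_Spaces.linear scale scale (\<lambda>y. f y x)" for x
    using assms by (auto simp: bilinear_map_def)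
  \<comment> \<open>The vector space axioms for \<open>scale\<close> come from the linearity facts
    themselves, since \<open>Vector_Spaces.linear\<close> includes them.\<close>
  interpret vector_space_pair scale scale
    using lin(1) by (simp add: Vector_Spaces.linear_def vector_space_pair_def)
  show ?thesis
    unfolding bilinear_map_def commutator_def
    by (intro conjI allI linear_compose_sub lin)
qed

text \<open>Writing [x,[y,z]] = x[y,z] - [y,z]x splits the Jacobi sum into two cyclic sums, each of
  which vanishes.\<close>

lemma (in anti_pre_lie_algebra) lie_algebra_commutator:
  "lie_algebra scale (commutator mult)"
proof unfold_locales
  show "bilinear_map scale (commutator mult)"
    using bilinear_mult by (rule bilinear_map_commutator)
  show "commutator mult x x = 0" for x
    by (simp add: commutator_def)
  have lin: "Vector_Spaces.linear scale scale (\<lambda>y. mult x y)"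
    "Vector_Spaces.linear scale scale (\<lambda>y. mult y x)" for x
    using bilinear_mult by (auto simp: bilinear_map_def)
  interpret vector_space_pair scale scale
    by unfold_locales
  have diff: "mult x (y - z) = mult x y - mult x z"
    "mult (y - z) x = mult y x - mult z x" for x y z
    by (rule linear_diff[OF lin(1)], rule linear_diff[OF lin(2)])
  show "commutator mult x (commutator mult y z) + commutator mult y (commutator mult z x)
      + commutator mult z (commutator mult x y) = 0" for x y z
  proof -
    \<comment> \<open>Cyclic sums of \<open>x(yz) - y(xz)\<close> and of \<open>x[y,z]\<close> agree, and the former vanishes by both axioms.\<close>
    have "(mult x (mult y z) - mult y (mult x z)) + (mult y (mult z x) - mult z (mult y x))
        + (mult z (mult x y) - mult x (mult z y)) = 0"
      \<comment> \<open>\<open>anti_left_symmetry\<close> reverses the bracket, leaving [y,x]z +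
        [z,y]x + [x,z]y; hence the instance with x and y swapped.\<close>
      using cyclic_identity[of y x z] unfolding anti_left_symmetry
      by (simp add: add_ac)
    then have "mult x (commutator mult y z) + mult y (commutator mult z x)
        + mult z (commutator mult x y) = 0"
      by (simp add: commutator_def diff algebra_simps)
    moreover have "mult (commutator mult x y) z + mult (commutator mult y z) x
        + mult (commutator mult z x) y = 0"
      by (rule cyclic_identity)
    ultimately show ?thesis
      \<comment> \<open>Only the outer commutators are expanded, so that the inner ones still match
        the two cyclic sums.\<close>
      unfolding commutator_def[of mult _ "commutator mult _ _"]
      by (simp add: algebra_simps neg_eq_iff_add_eq_0)
  qed
qed

lemma commutator_add_scale:
  fixes scale :: "'k::field \<Rightarrow> 'a::ab_group_add \<Rightarrow> 'a"
  assumes "vector_space scale"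
  shows "commutator (\<lambda>x y. f x y + scale t (g x y)) =
    (\<lambda>x y. commutator f x y + scale t (g x y - g y x))"
proof -
  interpret vector_space scale by fact
  show ?thesis
    by (simp add: fun_eq_iff commutator_def scale_right_diff_distrib)
qed

theorem proposition3p8:
  fixes scale :: "'k::field \<Rightarrow> 'a::ab_group_add \<Rightarrow> 'a"
    and mult \<Omega> :: "'a \<Rightarrow> 'a \<Rightarrow> 'a"
  assumes "anti_pre_lie_algebra scale mult"
    and "bilinear_map scale \<Omega>"
    and "generates_anti_pre_lie_deformation scale mult \<Omega>"
  shows "generates_lie_deformation scale (commutator mult) (\<lambda>x y. \<Omega> x y - \<Omega> y x)"
proof -
  interpret anti_pre_lie_algebra scale mult by fact
  have "bilinear_map scale (\<lambda>x y. \<Omega> x y - \<Omega> y x)"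
    using bilinear_map_commutator[OF assms(2)] by (simp add: commutator_def[abs_def])
  moreover have "lie_algebra scale (\<lambda>x y. commutator mult x y + scale t (\<Omega> x y - \<Omega> y x))" for t
  proof -
    have "anti_pre_lie_algebra scale (\<lambda>x y. mult x y + scale t (\<Omega> x y))"
      using assms(3) unfolding generates_anti_pre_lie_deformation_def by blast
    \<comment> \<open>Each \<open>t\<close> is treated separately, without comparing coefficients of
      powers of \<open>t\<close>, so the argument covers finite fields as well.\<close>
    from anti_pre_lie_algebra.lie_algebra_commutator[OF this] show ?thesis
      unfolding commutator_add_scale[OF vector_space_axioms] .
  qed
  ultimately show ?thesis
    unfolding generates_lie_deformation_def
    by (simp add: lie_algebra_commutator skew_symmetric_def)
qed

end
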